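(* Let $\{x_n\}$ be a sequence of real numbers converging to $\alpha\in\mathbb{R}$, generated by a one-point iterative method with memory for a nonlinear equation $f(x)=0$ with root $\alpha$. Let $e_n=x_n-\alpha$, with $e_n\neq 0$, and suppose that $$|e_{n+1}| = |C|\,|e_n|^{\rho}\,\bigl(1+O(|e_n|^{\sigma})\bigr)\qquad (n\to\infty),$$ where $C\neq 0$ is a real constant, $0<\sigma<1$ and $\rho\ge (1+\sqrt5)/2$ (so $\rho$ is the order of convergence). Let $$\overline{\lambda}_n=\frac{\log|e_n|}{\log|e_{n-1}|}$$ be the computational local order of convergence (CLOC). Then, as $n\to\infty$, $$\overline{\lambda}_n=\rho\left(1+O\!\left(\frac{\log|C|}{\rho\,\log|e_{n-1}|}\right)\right).$$
   Context: A one-point iterative method with memory for solving $f(x)=0$, where $f:I\subseteq\mathbb{R}\to\mathbb{R}$ and $I$ is a neighborhood of the root $\alpha$, is an iteration $x_{n+1}=\phi(x_n;x_{n-1},\dots,x_{n-j})$, $n\ge 0$, where $\phi$ is the iteration function; the case without memory ($j=0$) is allowed. The quantity $\overline{\lambda}_n$ is considered for iterates near the root, i.e. for $n$ large enough.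
   Formalization: The bound with log|C| in the O-term is stated for |C| ≠ 1; for |C| = 1, where that term is O(0) and the claim fails in general, the bound is O(1/(ρ log|e_{n-1}|)), which is also stated for every C ≠ 0. *)

theory Defs
  imports Complex_Main "HOL-Library.Landau_Symbols"
begin

text \<open>
  Sequences are indexed by the integers, because a method with memory \<open>j\<close> that produces
  \<open>x\<^sub>1, x\<^sub>2, \<dots>\<close> needs the starting values \<open>x\<^sub>-\<^sub>j, \<dots>, x\<^sub>0\<close>; values at indices below \<open>-j\<close> play no
  role. The list passed to the iteration function \<open>\<phi>\<close> is \<open>[x\<^sub>n\<^sub>-\<^sub>1, \<dots>, x\<^sub>n\<^sub>-\<^sub>j]\<close>, which is empty for a
  method without memory (\<open>j = 0\<close>).
\<close>
definition one_point_iteration ::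
    "nat \<Rightarrow> (real \<Rightarrow> real list \<Rightarrow> real) \<Rightarrow> (int \<Rightarrow> real) \<Rightarrow> bool" where
  "one_point_iteration j \<phi> x \<longleftrightarrow>
     (\<forall>n\<ge>0. x (n + 1) = \<phi> (x n) (map (\<lambda>i. x (n - int i)) [1..<j + 1]))"

text \<open>
  The computational local order of convergence, as a function of the errors
  \<open>e\<^sub>n = x\<^sub>n - \<alpha>\<close>. The quotient does not depend on the base of the logarithm. It is meaningful
  for large \<open>n\<close> only: division by zero yields \<open>0\<close> where \<open>\<bar>e\<^sub>n\<^sub>-\<^sub>1\<bar> = 1\<close>.
\<close>
definition cloc :: "(int \<Rightarrow> real) \<Rightarrow> int \<Rightarrow> real" where
  "cloc e n = ln \<bar>e n\<bar> / ln \<bar>e (n - 1)\<bar>"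

end

theory Submission imports Defs begin

text \<open>
  Taking logarithms turns the asymptotic relation into
  \<open>ln \<bar>e\<^sub>n\<bar> = \<rho> ln \<bar>e\<^sub>n\<^sub>-\<^sub>1\<bar> + (ln \<bar>C\<bar> + ln (1 + r\<^sub>n\<^sub>-\<^sub>1))\<close>. Since \<open>e\<^sub>n \<rightarrow> 0\<close> and \<open>\<sigma> > 0\<close>, the
  factor \<open>1 + r\<^sub>n\<close> tends to \<open>1\<close>, so the bracket tends to \<open>ln \<bar>C\<bar>\<close> and is in particular bounded.
  Dividing by \<open>\<rho> ln \<bar>e\<^sub>n\<^sub>-\<^sub>1\<bar>\<close> shows that the relative deviation of the CLOC from \<open>\<rho>\<close> is
  \<open>O(1 / (\<rho> ln \<bar>e\<^sub>n\<^sub>-\<^sub>1\<bar>))\<close>. When \<open>\<bar>C\<bar> \<noteq> 1\<close>, the nonzero constant \<open>ln \<bar>C\<bar>\<close> can be put into the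
  numerator without changing the order class; when \<open>\<bar>C\<bar> = 1\<close> that numerator would vanish, which
  is why the second form of the estimate is the one that covers all \<open>C\<close>.
\<close>

text \<open>
  Because \<open>\<sigma> > 0\<close>, the convergence \<open>e\<^sub>n \<rightarrow> 0\<close> gives \<open>\<bar>e\<^sub>n\<bar>\<^sup>\<sigma> \<rightarrow> 0\<close> and hence \<open>r\<^sub>n \<rightarrow> 0\<close>. So all three
  factors of the asymptotic relation are eventually positive, its logarithm splits into a sum,
  and the last summand \<open>ln (1 + r\<^sub>n)\<close> vanishes in the limit.
\<close>
lemma ln_error_defect_tendsto:
  fixes e r :: "int \<Rightarrow> real"
  assumes e0: "(e \<longlongrightarrow> 0) at_top"
    and nz: "\<forall>\<^sub>F n in at_top. e n \<noteq> 0"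
    and C: "C \<noteq> 0" and \<sigma>: "0 < \<sigma>"
    and r: "r \<in> O[at_top](\<lambda>n. \<bar>e n\<bar> powr \<sigma>)"
    and order: "\<forall>\<^sub>F n in at_top. \<bar>e (n + 1)\<bar> = \<bar>C\<bar> * \<bar>e n\<bar> powr \<rho> * (1 + r n)"
  shows "((\<lambda>n. ln \<bar>e (n + 1)\<bar> - \<rho> * ln \<bar>e n\<bar>) \<longlongrightarrow> ln \<bar>C\<bar>) at_top"
proof -
  have "((\<lambda>n. \<bar>e n\<bar> powr \<sigma>) \<longlongrightarrow> 0) at_top"
    using tendsto_zero_powrI[OF tendsto_rabs_zero[OF e0] tendsto_const _ \<sigma>] by simp
  then have "(\<lambda>n. \<bar>e n\<bar> powr \<sigma>) \<in> o[at_top](\<lambda>_. 1)"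
    by (intro smalloI_tendsto) simp_all
  with r have "r \<in> o[at_top](\<lambda>_. 1)"
    by (rule landau_o.big_small_trans)
  then have r0: "(r \<longlongrightarrow> 0) at_top"
    using smalloD_tendsto by fastforce
  have "((\<lambda>n. ln \<bar>C\<bar> + ln (1 + r n)) \<longlongrightarrow> ln \<bar>C\<bar> + ln (1 + 0)) at_top"
    by (intro tendsto_intros r0) simp
  moreover have "\<forall>\<^sub>F n in at_top. -1 < r n"
    using r0 by (rule order_tendstoD) simp
  then have "\<forall>\<^sub>F n in at_top. ln \<bar>C\<bar> + ln (1 + r n) = ln \<bar>e (n + 1)\<bar> - \<rho> * ln \<bar>e n\<bar>"
    using nz order
  proof eventually_elim
    case (elim n)
    then show ?case using C by (simp add: ln_mult ln_powr)
  qed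
  ultimately show ?thesis
    using Lim_transform_eventually by fastforce
qed

text \<open>
  The relative deviation is the convergent, hence bounded, difference \<open>ln \<bar>e\<^sub>n\<bar> - \<rho> ln \<bar>e\<^sub>n\<^sub>-\<^sub>1\<bar>\<close>
  divided by \<open>\<rho> ln \<bar>e\<^sub>n\<^sub>-\<^sub>1\<bar>\<close>. That divisor is nonzero for large \<open>n\<close>, where \<open>0 < \<bar>e\<^sub>n\<^sub>-\<^sub>1\<bar> < 1\<close>.
\<close>
lemma cloc_relative_deviation_bigo:
  fixes e r :: "int \<Rightarrow> real"
  assumes e0: "(e \<longlongrightarrow> 0) at_top"
    and nz: "\<forall>\<^sub>F n in at_top. e n \<noteq> 0"
    and C: "C \<noteq> 0" and \<sigma>: "0 < \<sigma>" and \<rho>: "\<rho> \<noteq> 0"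
    and r: "r \<in> O[at_top](\<lambda>n. \<bar>e n\<bar> powr \<sigma>)"
    and order: "\<forall>\<^sub>F n in at_top. \<bar>e (n + 1)\<bar> = \<bar>C\<bar> * \<bar>e n\<bar> powr \<rho> * (1 + r n)"
  shows "(\<lambda>n. cloc e n / \<rho> - 1) \<in> O[at_top](\<lambda>n. 1 / (\<rho> * ln \<bar>e (n - 1)\<bar>))"
proof -
  define g where "g n = ln \<bar>e (n + 1)\<bar> - \<rho> * ln \<bar>e n\<bar>" for n
  have shift: "filterlim (\<lambda>n::int. n - 1) at_top at_top"
    unfolding filterlim_at_top
  proof
    fix Z :: int
    show "\<forall>\<^sub>F n in at_top. Z \<le> n - 1"
      using eventually_ge_at_top[of "Z + 1"] by eventually_elim simp
  qed
  have "(g \<longlongrightarrow> ln \<bar>C\<bar>) at_top"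
    unfolding g_def by (rule ln_error_defect_tendsto[OF e0 nz C \<sigma> r order])
  then have "((\<lambda>n. g (n - 1)) \<longlongrightarrow> ln \<bar>C\<bar>) at_top"
    using shift by (rule filterlim_compose)
  then have "(\<lambda>n. g (n - 1)) \<in> O[at_top](\<lambda>_. 1)"
    by (intro bigoI_tendsto[where c = "ln \<bar>C\<bar>"]) simp_all
  from landau_o.big_mult[OF this landau_o.big_refl]
  have bound: "(\<lambda>n. g (n - 1) * (1 / (\<rho> * ln \<bar>e (n - 1)\<bar>)))
      \<in> O[at_top](\<lambda>n. 1 / (\<rho> * ln \<bar>e (n - 1)\<bar>))"
    by (simp only: mult_1)
  have "\<forall>\<^sub>F n in at_top. \<bar>e n\<bar> < 1"
    using tendsto_rabs_zero[OF e0] by (rule order_tendstoD) simp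
  with nz have "\<forall>\<^sub>F n in at_top. ln \<bar>e n\<bar> \<noteq> 0"
    by eventually_elim simp
  then have "\<forall>\<^sub>F n in at_top. ln \<bar>e (n - 1)\<bar> \<noteq> 0"
    using shift by (rule eventually_compose_filterlim)
  then have "\<forall>\<^sub>F n in at_top. cloc e n / \<rho> - 1 = g (n - 1) * (1 / (\<rho> * ln \<bar>e (n - 1)\<bar>))"
    by eventually_elim (use \<rho> in \<open>simp add: cloc_def g_def field_simps\<close>)
  then show ?thesis
    using bound by (rule landau_o.big.in_cong[THEN iffD2])
qed

theorem proposition3p1:
  fixes f :: "real \<Rightarrow> real" and I :: "real set"
    and \<phi> :: "real \<Rightarrow> real list \<Rightarrow> real" and j :: nat
    and x e :: "int \<Rightarrow> real" and \<alpha> C \<rho> \<sigma> :: real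
  assumes nbhd: "\<exists>\<delta>>0. {\<alpha> - \<delta><..<\<alpha> + \<delta>} \<subseteq> I"
    and root: "f \<alpha> = 0"
    and iteration: "one_point_iteration j \<phi> x"
    and lim: "(x \<longlongrightarrow> \<alpha>) at_top"
    and e: "\<And>n. e n = x n - \<alpha>"
    and nz: "\<And>n. n \<ge> 0 \<Longrightarrow> e n \<noteq> 0"
    and C: "C \<noteq> 0" and \<sigma>: "0 < \<sigma>" "\<sigma> < 1" and \<rho>: "\<rho> \<ge> (1 + sqrt 5) / 2"
    and order: "\<exists>r\<in>O[at_top](\<lambda>n. \<bar>e n\<bar> powr \<sigma>).
      \<forall>\<^sub>F n in at_top. \<bar>e (n + 1)\<bar> = \<bar>C\<bar> * \<bar>e n\<bar> powr \<rho> * (1 + r n)"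
  shows "(\<bar>C\<bar> \<noteq> 1 \<longrightarrow>
           (\<exists>s\<in>O[at_top](\<lambda>n. ln \<bar>C\<bar> / (\<rho> * ln \<bar>e (n - 1)\<bar>)).
              \<forall>\<^sub>F n in at_top. cloc e n = \<rho> * (1 + s n))) \<and>
         (\<exists>s\<in>O[at_top](\<lambda>n. 1 / (\<rho> * ln \<bar>e (n - 1)\<bar>)).
            \<forall>\<^sub>F n in at_top. cloc e n = \<rho> * (1 + s n))"
proof -
  have "0 < 1 + sqrt 5"
    by (simp add: add_pos_nonneg)
  with \<rho> have \<rho>0: "\<rho> \<noteq> 0" by auto
  have e0: "(e \<longlongrightarrow> 0) at_top"
    using lim unfolding e by (rule LIM_zero)
  have nz': "\<forall>\<^sub>F n in at_top. e n \<noteq> 0"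
    using eventually_ge_at_top[of 0] by eventually_elim (rule nz)
  define s where "s n = cloc e n / \<rho> - 1" for n
  have s: "s \<in> O[at_top](\<lambda>n. 1 / (\<rho> * ln \<bar>e (n - 1)\<bar>))"
    using order cloc_relative_deviation_bigo[OF e0 nz' C \<sigma>(1) \<rho>0] unfolding s_def by blast
  have cloc: "\<forall>\<^sub>F n in at_top. cloc e n = \<rho> * (1 + s n)"
    using \<rho>0 by (simp add: s_def)
  have "s \<in> O[at_top](\<lambda>n. ln \<bar>C\<bar> / (\<rho> * ln \<bar>e (n - 1)\<bar>))" if "\<bar>C\<bar> \<noteq> 1"
  proof -
    have "ln \<bar>C\<bar> \<noteq> 0" using C that by simp
    then show ?thesis
      using s landau_o.big.cmult[of "ln \<bar>C\<bar>" at_top "\<lambda>n. 1 / (\<rho> * ln \<bar>e (n - 1)\<bar>)"]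
      by (simp add: divide_inverse)
  qed
  with s cloc show ?thesis by blast
qed

end
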